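(* Let $m,k\ge1$ be integers, $n=mk$, and $\lambda_e,\lambda_s,\lambda_c>0$. Consider a clustered network with $m$ clusterheads, each serving a cluster of $k$ end-nodes, in which both the source-to-clusterhead network and every clusterhead-to-nodes network are disconnected. Write $(X,Y)$ for the configuration using scheme $X$ at the source-to-clusterhead stage and scheme $Y$ at the clusterhead-to-nodes stage, and put $a_s=\frac{\lambda_s}{\lambda_s+\lambda_e}$, $a_c=\frac{\lambda_c}{\lambda_c+\lambda_e}$. Then the long-term average freshness $\overline{F}_i$ of every end-node $i$ is: 1. for $(DC_{\mathrm{noRC}},DC_{\mathrm{noRC}})$: $\displaystyle \frac{\lambda_s}{\lambda_s+m\lambda_e}\cdot\frac{\lambda_c}{\lambda_c+k\lambda_e}$; 2. for $(DC_{\mathrm{noRC}},DC_{\mathrm{RC}})$: $\displaystyle \frac{\lambda_s}{\lambda_s+m\lambda_e}\cdot\frac{\lambda_c}{k\lambda_e}\left[1-a_c^{\,k}\right]$; 3. for $(DC_{\mathrm{RC}},DC_{\mathrm{noRC}})$: $\displaystyle \frac1m\frac{\lambda_s}{\lambda_e}\left[1-a_s^{\,m}\right]\cdot\frac{\lambda_c}{\lambda_c+k\lambda_e}$; 4. for $(DC_{\mathrm{RC}},DC_{\mathrm{RC}})$: $\displaystyle \left[\frac1m\frac{\lambda_s}{\lambda_e}(1-a_s^{\,m})\right]\cdot\left[\frac{\lambda_c}{k\lambda_e}(1-a_c^{\,k})\right]$.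
   Context: A source self-updates according to a Poisson process of rate $\lambda_e$. There are $n$ end-nodes divided into $m=n/k$ clusters of size $k$, each with a clusterhead (CH). The source sends updates only to the CHs, with total rate $\lambda_s$; each CH sends updates to its own $k$ end-nodes, with total rate $\lambda_c$. CHs do not communicate with each other, and end-nodes do not communicate with each other. A CH or end-node is fresh if it holds the current source version, and stale otherwise. For an end-node $i$, $F_i(t)=1$ if it is fresh at time $t$ and $F_i(t)=0$ otherwise, and $\overline{F}_i=\limsup_{T\to\infty}\frac1T\mathbb{E}\big[\int_0^T F_i(t)\,dt\big]$. The vector of fresh/stale states of all CHs and end-nodes is a continuous-time Markov chain, started with everything stale, with the following transitions. - At rate $\lambda_e$ the source self-updates and all CHs and end-nodes become stale. - Source-to-CH stage: each stale CH becomes fresh at rate $\lambda_s/m$ under $DC_{\mathrm{noRC}}$ (traditional gossip), and at rate $\lambda_s/(m-\ell)$ under $DC_{\mathrm{RC}}$ (rate-changing gossip), where $\ell$ is the current number of fresh CHs. - CH-to-nodes stage: an end-node can become fresh only while its CH is fresh. If its CH is fresh, each stale end-node of that cluster becomes fresh at rate $\lambda_c/k$ under $DC_{\mathrm{noRC}}$, and at rate $\lambda_c/(k-\ell')$ under $DC_{\mathrm{RC}}$, where $\ell'$ is the current number of fresh end-nodes in that cluster. All underlying Poisson clocks are independent. *)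

theory Defs
  imports "HOL-Probability.Probability"
begin

text \<open>
  A continuous-time Markov chain on a finite state space, in its infinitesimal description:
  a right-continuous process \<open>X\<close> with the Markov property, started at \<open>x0\<close>, that jumps from
  \<open>x\<close> to \<open>y \<noteq> x\<close> at rate \<open>q x y\<close>, i.e. \<open>P (X (t + h) = y | X t = x) = q x y * h + o(h)\<close> as
  \<open>h\<close> decreases to 0, uniformly in \<open>t\<close>.  The diagonal of \<open>q\<close> plays no role: the probability
  of staying at \<open>x\<close> is determined by the others since \<open>S\<close> is finite.  Conditions on
  conditional probabilities are imposed only where the conditioning event is not null.
\<close>

definition finite_ctmc ::
  "'w measure \<Rightarrow> 's set \<Rightarrow> ('s \<Rightarrow> 's \<Rightarrow> real) \<Rightarrow> 's \<Rightarrow> (real \<Rightarrow> 'w \<Rightarrow> 's) \<Rightarrow> bool" where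
  "finite_ctmc M S q x0 X \<longleftrightarrow>
     prob_space M \<and> finite S \<and>
     (\<forall>t\<ge>0. X t \<in> measurable M (count_space S)) \<and>
     (\<forall>\<omega>\<in>space M. \<forall>t\<ge>0. \<forall>\<^sub>F s in at_right t. X s \<omega> = X t \<omega>) \<and>
     (AE \<omega> in M. X 0 \<omega> = x0) \<and>
     (\<forall>t\<ge>0. \<forall>h\<ge>0. \<forall>J z. \<forall>x\<in>S. \<forall>y\<in>S.
        finite J \<longrightarrow> J \<subseteq> {0..t} \<longrightarrow>
        \<P>(\<omega> in M. X t \<omega> = x \<and> (\<forall>s\<in>J. X s \<omega> = z s)) > 0 \<longrightarrow>
        \<P>(\<omega> in M. X (t + h) \<omega> = y \<bar> X t \<omega> = x \<and> (\<forall>s\<in>J. X s \<omega> = z s)) =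
        \<P>(\<omega> in M. X (t + h) \<omega> = y \<bar> X t \<omega> = x)) \<and>
     (\<forall>x\<in>S. \<forall>y\<in>S. x \<noteq> y \<longrightarrow>
        uniform_limit {t. t \<ge> 0 \<and> \<P>(\<omega> in M. X t \<omega> = x) > 0}
          (\<lambda>h t. \<P>(\<omega> in M. X (t + h) \<omega> = y \<bar> X t \<omega> = x) / h) (\<lambda>t. q x y) (at_right 0))"

text \<open>
  \<open>CH j\<close> is the clusterhead of cluster \<open>j < m\<close> and \<open>Node j i\<close> is the \<open>i\<close>-th end-node
  (\<open>i < k\<close>) of that cluster.  The vector of fresh/stale states is encoded as the set of
  those clusterheads and end-nodes that are fresh; everything stale is the empty set.
\<close>

datatype entity = CH nat | Node nat nat

definition configs :: "nat \<Rightarrow> nat \<Rightarrow> entity set set" where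
  "configs m k = Pow ({CH j | j. j < m} \<union> {Node j i | j i. j < m \<and> i < k})"

datatype scheme = DC_noRC | DC_RC

text \<open>
  Rate at which each single stale receiver becomes fresh when the sender has total rate
  \<open>lam\<close> and \<open>N\<close> receivers, \<open>l\<close> of which are fresh.
\<close>

fun dc_rate :: "scheme \<Rightarrow> real \<Rightarrow> nat \<Rightarrow> nat \<Rightarrow> real" where
  "dc_rate DC_noRC lam N l = lam / real N"
| "dc_rate DC_RC lam N l = lam / (real N - real l)"

definition gossip_rate ::
  "nat \<Rightarrow> nat \<Rightarrow> real \<Rightarrow> real \<Rightarrow> real \<Rightarrow> scheme \<Rightarrow> scheme \<Rightarrow> entity set \<Rightarrow> entity set \<Rightarrow> real" where
  "gossip_rate m k lam_e lam_s lam_c A B x y =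
     (if y = {} then lam_e else 0) +
     (\<Sum>j | j < m \<and> CH j \<notin> x.
        if y = insert (CH j) x
        then dc_rate A lam_s m (card {j'. j' < m \<and> CH j' \<in> x}) else 0) +
     (\<Sum>j | j < m \<and> CH j \<in> x. \<Sum>i | i < k \<and> Node j i \<notin> x.
        if y = insert (Node j i) x
        then dc_rate B lam_c k (card {i'. i' < k \<and> Node j i' \<in> x}) else 0)"

definition clustered_gossip ::
  "nat \<Rightarrow> nat \<Rightarrow> real \<Rightarrow> real \<Rightarrow> real \<Rightarrow> scheme \<Rightarrow> scheme \<Rightarrow>
   'w measure \<Rightarrow> (real \<Rightarrow> 'w \<Rightarrow> entity set) \<Rightarrow> bool" where
  "clustered_gossip m k lam_e lam_s lam_c A B M X \<longleftrightarrow>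
     finite_ctmc M (configs m k) (gossip_rate m k lam_e lam_s lam_c A B) {} X"

definition fresh :: "(real \<Rightarrow> 'w \<Rightarrow> entity set) \<Rightarrow> entity \<Rightarrow> real \<Rightarrow> 'w \<Rightarrow> real" where
  "fresh X v t \<omega> = (if v \<in> X t \<omega> then 1 else 0)"

definition avg_freshness :: "'w measure \<Rightarrow> (real \<Rightarrow> 'w \<Rightarrow> entity set) \<Rightarrow> entity \<Rightarrow> ereal" where
  "avg_freshness M X v =
     Limsup at_top (\<lambda>T::real. ereal (1 / T * (LINT \<omega>|M. (LINT t:{0..T}|lborel. fresh X v t \<omega>))))"

end

theory Submission
  imports Defs
begin

text \<open>
  For every function \<open>f\<close> on the state space of a finite chain with generator \<open>Q\<close>, the time average
  of \<open>E (Q f) (X t)\<close> tends to 0.  Hence \<open>Q f = lam_e * (c - g)\<close> forces the average of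
  \<open>E g (X t)\<close> to tend to \<open>c\<close>.  When \<open>g\<close> indicates that a node is fresh, such an \<open>f\<close> is the
  probability of that node being fresh just before the next source update, because each update
  resets the chain to \<open>{}\<close>; the limit is then \<open>c = f {}\<close>.
\<close>

section \<open>Effect of a time shift on an integral\<close>

text \<open>The two windows differ only inside \<open>{0..h}\<close> and \<open>{T..T + h}\<close>,
  also when \<open>h > T\<close>, and each of these layers contributes at most
  \<open>B * h\<close>.\<close>

lemma abs_integral_shift_le:
  fixes g :: "real \<Rightarrow> real"
  assumes "0 \<le> h" "0 \<le> T"
    and int: "\<And>a b. 0 \<le> a \<Longrightarrow> set_integrable lborel {a..b} g"
    and bound: "\<And>t. 0 \<le> t \<Longrightarrow> \<bar>g t\<bar> \<le> B"
  shows "\<bar>(LINT t:{h..T + h}|lborel. g t) - (LINT t:{0..T}|lborel. g t)\<bar> \<le> 2 * B * h"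
proof -
  define d where "d t = indicator {h..T + h} t *\<^sub>R g t - indicator {0..T} t *\<^sub>R g t" for t
  define b where "b t = B * indicator {0..h} t + B * indicator {T..T + h} t" for t :: real
  have i: "integrable lborel (\<lambda>t. indicator {h..T + h} t *\<^sub>R g t)"
      "integrable lborel (\<lambda>t. indicator {0..T} t *\<^sub>R g t)"
    using int[of h "T + h"] int[of 0 T] assms(1) by (simp_all add: set_integrable_def)
  have ind: "integrable lborel (indicator {u..v} :: real \<Rightarrow> real)" for u v
    by (simp add: emeasure_lborel_Icc_eq)
  have "integrable lborel d"
    using i by (simp add: d_def[abs_def])
  moreover have "integrable lborel b"
    unfolding b_def[abs_def] by (simp add: ind)
  moreover have "\<bar>d t\<bar> \<le> b t" for t
  proof (cases "0 \<le> t")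
    case True
    have "0 \<le> B" using bound[of 0] by simp
    with bound[OF True] True show ?thesis
      using assms(1,2) unfolding d_def b_def by (auto simp: indicator_def)
  next
    case False
    then show ?thesis using assms(1,2) by (simp add: d_def b_def)
  qed
  ultimately have "(LINT t|lborel. \<bar>d t\<bar>) \<le> (LINT t|lborel. b t)"
    by (intro integral_mono) auto
  also have "\<dots> = 2 * B * h"
    using assms(1,2) unfolding b_def by (simp add: ind)
  finally have "\<bar>LINT t|lborel. d t\<bar> \<le> 2 * B * h"
    using integral_abs_bound[of lborel d] by linarith
  moreover have "(LINT t|lborel. d t) = (LINT t:{h..T + h}|lborel. g t) - (LINT t:{0..T}|lborel. g t)"
    unfolding set_lebesgue_integral_def d_def using i by simp
  ultimately show ?thesis by simp
qed

section \<open>Expectations along a finite chain\<close>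

locale ctmc =
  fixes M :: "'w measure" and S :: "'s set" and q :: "'s \<Rightarrow> 's \<Rightarrow> real" and x0 :: 's
    and X :: "real \<Rightarrow> 'w \<Rightarrow> 's"
  assumes finite_ctmc: "finite_ctmc M S q x0 X"
begin

definition mean :: "('s \<Rightarrow> real) \<Rightarrow> real \<Rightarrow> real" where
  "mean f t = (LINT \<omega>|M. f (X t \<omega>))"

text \<open>The difference form builds in the total exit rate: the term \<open>y = x\<close>
  vanishes, and the remaining rates are those that \<open>finite_ctmc\<close> prescribes.\<close>

definition generator :: "('s \<Rightarrow> real) \<Rightarrow> 's \<Rightarrow> real" where
  "generator f x = (\<Sum>y\<in>S. q x y * (f y - f x))"

lemma finite_S: "finite S"
  using finite_ctmc by (simp add: finite_ctmc_def)

lemma X_measurable [measurable]: "0 \<le> t \<Longrightarrow> X t \<in> measurable M (count_space S)"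
  using finite_ctmc by (simp add: finite_ctmc_def)

lemma X_right_continuous:
  "\<omega> \<in> space M \<Longrightarrow> 0 \<le> t \<Longrightarrow> \<forall>\<^sub>F s in at_right t. X s \<omega> = X t \<omega>"
  using finite_ctmc by (simp add: finite_ctmc_def)

lemma X_in_S: "0 \<le> t \<Longrightarrow> \<omega> \<in> space M \<Longrightarrow> X t \<omega> \<in> S"
  using measurable_space[OF X_measurable] by simp

lemma jump_rate:
  "x \<in> S \<Longrightarrow> y \<in> S \<Longrightarrow> x \<noteq> y \<Longrightarrow>
    uniform_limit {t. t \<ge> 0 \<and> \<P>(\<omega> in M. X t \<omega> = x) > 0}
      (\<lambda>h t. \<P>(\<omega> in M. X (t + h) \<omega> = y \<bar> X t \<omega> = x) / h) (\<lambda>t. q x y) (at_right 0)"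
  using finite_ctmc by (simp add: finite_ctmc_def)

sublocale prob_space M
  using finite_ctmc by (simp add: finite_ctmc_def)

lemma comp_X_measurable:
  fixes f :: "'s \<Rightarrow> real"
  assumes "0 \<le> t"
  shows "(\<lambda>\<omega>. f (X t \<omega>)) \<in> borel_measurable M"
  using measurable_compose[OF X_measurable[OF assms], of f borel] by simp

lemma abs_le_bound:
  fixes f :: "'s \<Rightarrow> real"
  shows "x \<in> S \<Longrightarrow> \<bar>f x\<bar> \<le> (\<Sum>y\<in>S. \<bar>f y\<bar>)"
  by (rule member_le_sum[of x S "\<lambda>y. \<bar>f y\<bar>"]) (auto simp: finite_S)

lemma integrable_comp_X:
  fixes f :: "'s \<Rightarrow> real"
  assumes "0 \<le> t"
  shows "integrable M (\<lambda>\<omega>. f (X t \<omega>))"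
  by (rule integrable_const_bound[where B = "\<Sum>y\<in>S. \<bar>f y\<bar>"])
     (auto intro!: AE_I2 abs_le_bound X_in_S comp_X_measurable assms)

lemma abs_mean_le:
  assumes "0 \<le> t"
  shows "\<bar>mean f t\<bar> \<le> (\<Sum>y\<in>S. \<bar>f y\<bar>)"
proof -
  have "\<bar>mean f t\<bar> \<le> (LINT \<omega>|M. \<bar>f (X t \<omega>)\<bar>)"
    unfolding mean_def by (rule integral_abs_bound)
  also have "\<dots> \<le> (LINT \<omega>|M. (\<Sum>y\<in>S. \<bar>f y\<bar>))"
    using assms by (intro integral_mono integrable_abs integrable_comp_X)
      (auto intro!: abs_le_bound X_in_S)
  finally show ?thesis by (simp add: prob_space)
qed

text \<open>The grid points \<open>(\<lfloor>n t\<rfloor> + 1) / n\<close> decrease strictly to \<open>t\<close>, so right-continuity makes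
  the process a pointwise limit of processes that are measurable in \<open>(t, \<omega>)\<close>.\<close>

lemma jointly_measurable:
  fixes f :: "'s \<Rightarrow> real"
  shows "(\<lambda>(t, \<omega>). f (X (max 0 t) \<omega>)) \<in> borel_measurable (lborel \<Otimes>\<^sub>M M)"
proof -
  define d :: "nat \<Rightarrow> real \<Rightarrow> int" where "d n t = \<lfloor>real (Suc n) * max 0 t\<rfloor>" for n t
  \<comment> \<open>The clamp on \<open>z\<close> keeps the time nonnegative for every integer, as
    the measurability argument for fixed \<open>z\<close> requires; the values of \<open>d\<close>
    are nonnegative already.\<close>
  define a :: "nat \<Rightarrow> int \<Rightarrow> real" where "a n z = (max 0 (real_of_int z) + 1) / real (Suc n)" for n z
  have meas: "(\<lambda>p. f (X (a n (d n (fst p))) (snd p))) \<in> borel_measurable (lborel \<Otimes>\<^sub>M M)" for n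
  \<comment> \<open>The index \<open>d n\<close> takes countably many values, so one fixed time can
    be treated at once.\<close>
  proof (rule measurable_compose_countable[where g = "\<lambda>p. d n (fst p)"
        and f = "\<lambda>z p. f (X (a n z) (snd p))"])
    fix z :: int
    have "0 \<le> a n z" by (simp add: a_def)
    from comp_X_measurable[OF this, of f]
    show "(\<lambda>p. f (X (a n z) (snd p))) \<in> borel_measurable (lborel \<Otimes>\<^sub>M M)"
      by (rule measurable_compose[OF measurable_snd])
  next
    show "(\<lambda>p. d n (fst p)) \<in> measurable (lborel \<Otimes>\<^sub>M M) (count_space UNIV)"
      unfolding d_def by measurable
  qed
  have lim: "(\<lambda>n. f (X (a n (d n t)) \<omega>)) \<longlonglongrightarrow> f (X (max 0 t) \<omega>)" if \<omega>: "\<omega> \<in> space M" for t \<omega>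
  proof -
    define u where "u = max 0 t"
    have u: "0 \<le> u" by (simp add: u_def)
    define s where "s n = a n (d n t)" for n
    have s_eq: "s n = (real_of_int \<lfloor>real (Suc n) * u\<rfloor> + 1) / real (Suc n)" for n
      using u unfolding s_def a_def d_def u_def[symmetric] by (simp add: max_def)
    have gt: "u < s n" for n
    proof -
      have "u * real (Suc n) < real_of_int \<lfloor>real (Suc n) * u\<rfloor> + 1"
        unfolding mult.commute[of u] by linarith
      then show ?thesis unfolding s_eq by (simp only: pos_less_divide_eq of_nat_0_less_iff zero_less_Suc)
    qed
    have le: "s n \<le> u + inverse (real (Suc n))" for n
    proof -
      have "real_of_int \<lfloor>real (Suc n) * u\<rfloor> + 1 \<le> real (Suc n) * u + 1" by linarith
      then have "s n \<le> (real (Suc n) * u + 1) / real (Suc n)"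
        unfolding s_eq by (rule divide_right_mono) simp
      then show ?thesis by (simp add: add_divide_distrib inverse_eq_divide)
    qed
    have "(\<lambda>n. u + inverse (real (Suc n))) \<longlonglongrightarrow> u + 0"
      by (intro tendsto_add tendsto_const LIMSEQ_inverse_real_of_nat)
    then have upper: "(\<lambda>n. u + inverse (real (Suc n))) \<longlonglongrightarrow> u" by (simp only: add_0_right)
    have "s \<longlonglongrightarrow> u"
      by (rule tendsto_sandwich[OF _ _ tendsto_const upper])
         (intro always_eventually allI less_imp_le[OF gt] le)+
    moreover have "\<forall>\<^sub>F n in sequentially. s n \<in> {u<..} - {u}"
      using gt by (intro always_eventually allI) (simp add: less_imp_neq[symmetric])
    ultimately have "filterlim s (at_right u) sequentially"
      by (rule filterlim_at_withinI)
    with X_right_continuous[OF \<omega> u]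
    have "\<forall>\<^sub>F n in sequentially. X (s n) \<omega> = X u \<omega>"
      by (rule eventually_compose_filterlim)
    then have "\<forall>\<^sub>F n in sequentially. f (X (s n) \<omega>) = f (X u \<omega>)"
      by eventually_elim (rule arg_cong)
    then show ?thesis unfolding s_def u_def by (rule tendsto_eventually)
  qed
  show ?thesis
    unfolding case_prod_beta
    by (rule borel_measurable_LIMSEQ_real[OF lim meas]) (simp add: space_pair_measure mem_Times_iff)
qed

lemma mean_measurable: "(\<lambda>t. mean f (max 0 t)) \<in> borel_measurable lborel"
  unfolding mean_def
  using borel_measurable_lebesgue_integral[OF jointly_measurable[of f]] by simp

lemma set_integrable_mean:
  assumes "0 \<le> a"
  shows "set_integrable lborel {a..b} (mean f)"
proof -
  let ?B = "\<Sum>y\<in>S. \<bar>f y\<bar>"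
  have "integrable lborel (\<lambda>t. indicator {a..b} t *\<^sub>R mean f (max 0 t))"
  proof (rule integrableI_bounded_set[where A = "{a..b}" and B = ?B])
    show "(\<lambda>t. indicator {a..b} t *\<^sub>R mean f (max 0 t)) \<in> borel_measurable lborel"
      by (intro borel_measurable_scaleR mean_measurable) measurable
    show "emeasure lborel {a..b} < \<infinity>" by (simp add: emeasure_lborel_Icc_eq)
  qed (auto simp: indicator_def intro!: AE_I2 abs_mean_le sum_nonneg)
  moreover have "(\<lambda>t. indicator {a..b} t *\<^sub>R mean f (max 0 t)) = (\<lambda>t. indicator {a..b} t *\<^sub>R mean f t)"
    using assms by (auto simp: indicator_def)
  ultimately show ?thesis by (simp add: set_integrable_def)
qed

text \<open>Fubini applies because the integrand is bounded and jointly measurable. The left side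
  has the order of integration used in \<open>avg_freshness\<close>.\<close>

lemma integral_time_average:
  "(LINT \<omega>|M. (LINT t:{0..T}|lborel. f (X t \<omega>))) = (LINT t:{0..T}|lborel. mean f t)"
proof -
  interpret pair_sigma_finite lborel M ..
  let ?g = "\<lambda>t \<omega>. indicator {0..T} t * f (X (max 0 t) \<omega>)"
  let ?B = "\<Sum>y\<in>S. \<bar>f y\<bar>"
  have "integrable (lborel \<Otimes>\<^sub>M M) (case_prod ?g)"
  proof (rule integrableI_bounded_set[where A = "{0..T} \<times> space M" and B = ?B])
    show "{0..T} \<times> space M \<in> sets (lborel \<Otimes>\<^sub>M M)" by (intro pair_measureI) auto
    have "(\<lambda>p. indicator {0..T} (fst p) * (case p of (t, \<omega>) \<Rightarrow> f (X (max 0 t) \<omega>)))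
        \<in> borel_measurable (lborel \<Otimes>\<^sub>M M)"
      by (intro borel_measurable_times jointly_measurable) measurable
    then show "case_prod ?g \<in> borel_measurable (lborel \<Otimes>\<^sub>M M)"
      by (simp add: case_prod_beta')
    show "emeasure (lborel \<Otimes>\<^sub>M M) ({0..T} \<times> space M) < \<infinity>"
      by (subst sigma_finite_measure.emeasure_pair_measure_Times
            [OF prob_space_imp_sigma_finite[OF prob_space_axioms]])
         (auto simp: emeasure_space_1 emeasure_lborel_Icc_eq)
    show "AE p in lborel \<Otimes>\<^sub>M M. p \<in> {0..T} \<times> space M \<longrightarrow> norm (case_prod ?g p) \<le> ?B"
    proof (rule AE_I2, clarify)
      fix t :: real and \<omega> assume "(t, \<omega>) \<in> space (lborel \<Otimes>\<^sub>M M)"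
      then have "\<bar>f (X (max 0 t) \<omega>)\<bar> \<le> ?B"
        by (intro abs_le_bound X_in_S) (auto simp: space_pair_measure)
      then show "norm (indicator {0..T} t * f (X (max 0 t) \<omega>)) \<le> ?B"
        by (auto simp: indicator_def intro: sum_nonneg)
    qed
  qed (auto simp: indicator_def space_pair_measure)
  then have "(LINT \<omega>|M. (LINT t|lborel. ?g t \<omega>)) = (LINT t|lborel. (LINT \<omega>|M. ?g t \<omega>))"
    by (rule Fubini_integral)
  moreover have "?g t \<omega> = indicator {0..T} t * f (X t \<omega>)" for t \<omega>
    by (auto simp: indicator_def)
  ultimately show ?thesis
    by (simp add: set_lebesgue_integral_def mean_def)
qed

section \<open>Infinitesimal increments of a mean\<close>

lemma X_eq_sets [measurable]: "0 \<le> t \<Longrightarrow> {\<omega> \<in> space M. X t \<omega> = x} \<in> sets M"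
  using measurable_sets[OF X_measurable, of t "{x} \<inter> S"] X_in_S[of t]
  by (simp add: vimage_def Int_def conj_commute cong: conj_cong)

lemma X_eq_eq_sets [measurable]:
  "0 \<le> s \<Longrightarrow> 0 \<le> t \<Longrightarrow> {\<omega> \<in> space M. X s \<omega> = y \<and> X t \<omega> = x} \<in> sets M"
  by (rule sets.sets_Collect_conj) (rule X_eq_sets; assumption)+

lemma integrable_event: "A \<in> sets M \<Longrightarrow> integrable M (indicator A :: _ \<Rightarrow> real)"
  by (simp add: less_top[symmetric])

lemma mean_eq_sum:
  assumes "0 \<le> t"
  shows "mean f t = (\<Sum>x\<in>S. f x * \<P>(\<omega> in M. X t \<omega> = x))"
proof -
  have "mean f t = (LINT \<omega>|M. (\<Sum>x\<in>S. f x * indicator {\<omega> \<in> space M. X t \<omega> = x} \<omega>))"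
    unfolding mean_def
  proof (rule Bochner_Integration.integral_cong[OF refl])
    fix \<omega> assume "\<omega> \<in> space M"
    then show "f (X t \<omega>) = (\<Sum>x\<in>S. f x * indicator {\<omega> \<in> space M. X t \<omega> = x} \<omega>)"
      using X_in_S[OF assms] finite_S by (simp add: indicator_def if_distrib cong: if_cong)
  qed
  then show ?thesis
    by (simp add: Bochner_Integration.integral_sum integrable_event X_eq_sets assms)
qed

text \<open>The expectation is split by the pair of states at the two times. Pairs with
  \<open>y = x\<close> carry weight 0, so off-diagonal jump rates suffice later.\<close>

lemma mean_increment:
  assumes "0 \<le> t" "0 \<le> h"
  shows "mean f (t + h) - mean f t =
    (\<Sum>x\<in>S. \<Sum>y\<in>S. (f y - f x) * \<P>(\<omega> in M. X (t + h) \<omega> = y \<and> X t \<omega> = x))"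
proof -
  have th: "0 \<le> t + h" using assms by simp
  have "mean f (t + h) - mean f t = (LINT \<omega>|M. f (X (t + h) \<omega>) - f (X t \<omega>))"
    unfolding mean_def using assms by (simp add: integrable_comp_X)
  also have "\<dots> = (LINT \<omega>|M. (\<Sum>x\<in>S. \<Sum>y\<in>S. (f y - f x) *
      indicator {\<omega> \<in> space M. X (t + h) \<omega> = y \<and> X t \<omega> = x} \<omega>))"
  proof (rule Bochner_Integration.integral_cong[OF refl])
    fix \<omega> assume w: "\<omega> \<in> space M"
    have "(\<Sum>x\<in>S. \<Sum>y\<in>S. (f y - f x) * indicator {\<omega> \<in> space M. X (t + h) \<omega> = y \<and> X t \<omega> = x} \<omega>)
      = (\<Sum>x\<in>S. \<Sum>y\<in>S. if x = X t \<omega> then if y = X (t + h) \<omega> then f y - f x else 0 else 0)"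
      using w by (intro sum.cong) (auto simp: indicator_def)
    also have "\<dots> = (\<Sum>x\<in>S. if x = X t \<omega> then f (X (t + h) \<omega>) - f x else 0)"
      using X_in_S[OF th w] finite_S by (intro sum.cong) auto
    also have "\<dots> = f (X (t + h) \<omega>) - f (X t \<omega>)"
      using X_in_S[OF assms(1) w] finite_S by simp
    finally show "f (X (t + h) \<omega>) - f (X t \<omega>) = (\<Sum>x\<in>S. \<Sum>y\<in>S. (f y - f x) *
      indicator {\<omega> \<in> space M. X (t + h) \<omega> = y \<and> X t \<omega> = x} \<omega>)" by simp
  qed
  also have "\<dots> = (\<Sum>x\<in>S. \<Sum>y\<in>S. (f y - f x) * \<P>(\<omega> in M. X (t + h) \<omega> = y \<and> X t \<omega> = x))"
    by (simp add: Bochner_Integration.integral_sum integrable_event X_eq_eq_sets th assms)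
  finally show ?thesis .
qed

text \<open>Multiplying the conditional estimate by the probability of \<open>x\<close>, which is at
  most 1, preserves the error. At times where \<open>x\<close> is null, which the assumed uniform
  limit leaves out, both terms are 0.\<close>

lemma joint_prob_rate:
  assumes "x \<in> S" "y \<in> S" "x \<noteq> y" "0 < \<epsilon>"
  shows "\<forall>\<^sub>F h in at_right 0. \<forall>t\<ge>0.
    \<bar>\<P>(\<omega> in M. X (t + h) \<omega> = y \<and> X t \<omega> = x) / h - q x y * \<P>(\<omega> in M. X t \<omega> = x)\<bar> \<le> \<epsilon>"
  using uniform_limitD[OF jump_rate[OF assms(1-3)] assms(4)] eventually_at_right_less[of 0]
proof eventually_elim
  case (elim h)
  show ?case
  proof (intro allI impI)
    fix t :: real assume t: "0 \<le> t"
    let ?p = "\<P>(\<omega> in M. X t \<omega> = x)" and ?j = "\<P>(\<omega> in M. X (t + h) \<omega> = y \<and> X t \<omega> = x)"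
    have jp: "?j \<le> ?p" by (rule finite_measure_mono) (auto intro: X_eq_sets t)
    show "\<bar>?j / h - q x y * ?p\<bar> \<le> \<epsilon>"
    proof (cases "?p = 0")
      case True
      then have "?j = 0" using jp by (simp add: measure_le_0_iff)
      with True show ?thesis using assms(4) by simp
    next
      case False
      then have p: "0 < ?p" using measure_nonneg[of M] by (simp add: less_le)
      then have "\<bar>?j / ?p / h - q x y\<bar> < \<epsilon>"
        using elim t by (auto simp: dist_real_def cond_prob_def)
      moreover have "?j / h - q x y * ?p = (?j / ?p / h - q x y) * ?p"
        using p by (simp add: field_simps)
      ultimately have "\<bar>?j / h - q x y * ?p\<bar> \<le> \<epsilon> * ?p"
        using p by (simp add: abs_mult)
      also have "\<dots> \<le> \<epsilon> * 1" using assms(4) by (intro mult_left_mono prob_le_1) auto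
      finally show ?thesis by simp
    qed
  qed
qed

text \<open>A weak form of Kolmogorov's forward equation. Uniformity in \<open>t\<close> is the
  point: one \<open>h\<close> later serves the whole of \<open>{0..T}\<close>, for all
  \<open>T\<close>.\<close>

lemma mean_right_derivative:
  assumes "0 < \<epsilon>"
  shows "\<forall>\<^sub>F h in at_right 0. \<forall>t\<ge>0. \<bar>(mean f (t + h) - mean f t) / h - mean (generator f) t\<bar> \<le> \<epsilon>"
proof -
  define K where "K = (\<Sum>x\<in>S. \<Sum>y\<in>S. \<bar>f y - f x\<bar>)"
  have K: "0 \<le> K" unfolding K_def by (intro sum_nonneg) auto
  \<comment> \<open>The \<open>+ 1\<close> keeps the divisor positive when \<open>f\<close> is
    constant on \<open>S\<close>.\<close>
  define \<delta> where "\<delta> = \<epsilon> / (K + 1)"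
  have \<delta>: "0 < \<delta>" "K * \<delta> \<le> \<epsilon>" using assms K by (auto simp: \<delta>_def field_simps)
  have "\<forall>\<^sub>F h in at_right 0. \<forall>x\<in>S. \<forall>y\<in>S. x \<noteq> y \<longrightarrow> (\<forall>t\<ge>0.
    \<bar>\<P>(\<omega> in M. X (t + h) \<omega> = y \<and> X t \<omega> = x) / h - q x y * \<P>(\<omega> in M. X t \<omega> = x)\<bar> \<le> \<delta>)"
    using joint_prob_rate \<delta>(1) finite_S
    by (intro eventually_ball_finite ballI) (auto simp: eventually_conj_iff)
  then show ?thesis using eventually_at_right_less[of 0]
  proof eventually_elim
    case (elim h)
    show ?case
    proof (intro allI impI)
      fix t :: real assume t: "0 \<le> t"
      let ?p = "\<lambda>x. \<P>(\<omega> in M. X t \<omega> = x)" and ?j = "\<lambda>x y. \<P>(\<omega> in M. X (t + h) \<omega> = y \<and> X t \<omega> = x)"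
      have "(mean f (t + h) - mean f t) / h - mean (generator f) t
          = (\<Sum>x\<in>S. \<Sum>y\<in>S. (f y - f x) * (?j x y / h - q x y * ?p x))"
      proof -
        have "(mean f (t + h) - mean f t) / h = (\<Sum>x\<in>S. \<Sum>y\<in>S. (f y - f x) * ?j x y / h)"
          using t elim(2) by (simp add: mean_increment sum_divide_distrib)
        moreover have "mean (generator f) t = (\<Sum>x\<in>S. \<Sum>y\<in>S. (f y - f x) * (q x y * ?p x))"
          using t by (simp add: mean_eq_sum generator_def sum_distrib_right mult_ac)
        ultimately show ?thesis
          by (simp add: sum_subtractf[symmetric] right_diff_distrib)
      qed
      also have "\<bar>\<dots>\<bar> \<le> (\<Sum>x\<in>S. \<Sum>y\<in>S. \<bar>(f y - f x) * (?j x y / h - q x y * ?p x)\<bar>)"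
        by (intro order_trans[OF sum_abs] sum_mono sum_abs)
      also have "\<dots> \<le> (\<Sum>x\<in>S. \<Sum>y\<in>S. \<bar>f y - f x\<bar> * \<delta>)"
      proof (intro sum_mono)
        fix x y assume "x \<in> S" "y \<in> S"
        then show "\<bar>(f y - f x) * (?j x y / h - q x y * ?p x)\<bar> \<le> \<bar>f y - f x\<bar> * \<delta>"
          using elim(1) t by (cases "x = y") (auto simp: abs_mult intro!: mult_left_mono)
      qed
      also have "\<dots> = K * \<delta>" by (simp add: K_def sum_distrib_right)
      finally show "\<bar>(mean f (t + h) - mean f t) / h - mean (generator f) t\<bar> \<le> \<epsilon>"
        using \<delta>(2) by simp
    qed
  qed
qed

section \<open>Time averages\<close>

lemma integral_shifted_mean:
  assumes "0 \<le> h"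
  shows "set_integrable lborel {0..T} (\<lambda>t. mean f (t + h))"
    and "(LINT t:{0..T}|lborel. mean f (t + h)) = (LINT t:{h..T + h}|lborel. mean f t)"
proof -
  have eq: "(\<lambda>t. indicator {h..T + h} (h + 1 * t) *\<^sub>R mean f (h + 1 * t))
      = (\<lambda>t. indicator {0..T} t *\<^sub>R mean f (t + h))"
    by (auto simp: indicator_def add.commute)
  show "set_integrable lborel {0..T} (\<lambda>t. mean f (t + h))"
    using lborel_integrable_real_affine[of "\<lambda>t. indicator {h..T + h} t *\<^sub>R mean f t" 1 h]
      set_integrable_mean[OF assms, of "T + h" f]
    unfolding set_integrable_def eq by simp
  show "(LINT t:{0..T}|lborel. mean f (t + h)) = (LINT t:{h..T + h}|lborel. mean f t)"
    unfolding set_lebesgue_integral_def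
    by (subst (2) lborel_integral_real_affine[of 1 _ h]) (simp_all only: eq, simp_all)
qed

text \<open>Averaging the difference quotient of \<open>mean f\<close> over \<open>{0..T}\<close> leaves only two boundary
  layers of length \<open>h\<close>, so it vanishes as \<open>T\<close> grows with \<open>h\<close> fixed; no forward equation is solved.\<close>

lemma time_average_generator:
  "((\<lambda>T. 1 / T * (LINT t:{0..T}|lborel. mean (generator f) t)) \<longlongrightarrow> 0) at_top"
proof (rule tendstoI)
  fix \<epsilon> :: real assume \<epsilon>: "0 < \<epsilon>"
  let ?B = "\<Sum>y\<in>S. \<bar>f y\<bar>"
  have "\<forall>\<^sub>F h in at_right 0. 0 < h \<and> (\<forall>t\<ge>0. \<bar>(mean f (t + h) - mean f t) / h - mean (generator f) t\<bar> \<le> \<epsilon> / 2)"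
    using mean_right_derivative[of "\<epsilon> / 2" f] eventually_at_right_less[of 0] \<epsilon>
    by (simp add: eventually_conj_iff)
  then obtain h where h: "0 < h"
    and close: "\<And>t. 0 \<le> t \<Longrightarrow> \<bar>(mean f (t + h) - mean f t) / h - mean (generator f) t\<bar> \<le> \<epsilon> / 2"
    using eventually_happens'[OF trivial_limit_at_right_real] by blast
  \<comment> \<open>The boundary layers contribute at most \<open>2 * ?B\<close>; past this
    threshold that is less than \<open>T * \<epsilon> / 2\<close>.\<close>
  have "\<forall>\<^sub>F T in at_top. 4 * ?B / \<epsilon> < T \<and> 0 < T"
    by (intro eventually_conj eventually_gt_at_top)
  then show "\<forall>\<^sub>F T in at_top. dist (1 / T * (LINT t:{0..T}|lborel. mean (generator f) t)) 0 < \<epsilon>"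
  proof eventually_elim
    case (elim T)
    let ?I = "LINT t:{0..T}|lborel. mean (generator f) t"
    let ?D = "LINT t:{0..T}|lborel. (mean f (t + h) - mean f t) / h"
    note int = integral_shifted_mean(1)[of h T f] set_integrable_mean[of 0 T f]
      set_integrable_mean[of 0 T "generator f"]
    have intD: "set_integrable lborel {0..T} (\<lambda>t. (mean f (t + h) - mean f t) / h)"
      using int h by (intro set_integrable_divide set_integral_diff) auto
    have "?D = ((LINT t:{0..T}|lborel. mean f (t + h)) - (LINT t:{0..T}|lborel. mean f t)) / h"
      using int h by (simp add: set_integral_diff)
    then have "\<bar>?D\<bar> \<le> 2 * ?B * h / h"
      using abs_integral_shift_le[of h T "mean f" ?B] set_integrable_mean abs_mean_le h elim
      by (simp add: integral_shifted_mean(2) abs_divide divide_le_eq)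
    then have D: "\<bar>?D\<bar> \<le> 2 * ?B" using h by simp
    have "?D - ?I = (LINT t:{0..T}|lborel. (mean f (t + h) - mean f t) / h - mean (generator f) t)"
      using intD int by (simp add: set_integral_diff)
    also have "\<bar>\<dots>\<bar> \<le> (LINT t:{0..T}|lborel. \<epsilon> / 2)"
      unfolding set_lebesgue_integral_def
    proof (rule order_trans[OF integral_abs_bound integral_mono])
      show "integrable lborel (\<lambda>t. \<bar>indicator {0..T} t *\<^sub>R ((mean f (t + h) - mean f t) / h - mean (generator f) t)\<bar>)"
        using set_integral_diff(1)[OF intD int(3)] unfolding set_integrable_def
        by (intro integrable_abs) auto
      show "integrable lborel (\<lambda>t. indicator {0..T} t *\<^sub>R (\<epsilon> / 2))"
        by (simp add: emeasure_lborel_Icc_eq)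
    qed (use close in \<open>auto simp: indicator_def\<close>)
    also have "\<dots> = T * \<epsilon> / 2" using elim by (simp add: set_lebesgue_integral_def)
    finally have "\<bar>?I\<bar> \<le> 2 * ?B + T * \<epsilon> / 2" using D by linarith
    also have "\<dots> < T * \<epsilon>" using elim \<epsilon> by (simp add: field_simps)
    finally show ?case using elim by (simp add: abs_mult field_simps)
  qed
qed

text \<open>Solving the hypothesis for \<open>g\<close> gives \<open>mean g\<close> as
  \<open>c\<close> minus \<open>mean (generator f) / r\<close>, whose average vanishes. Exhibiting
  one such \<open>f\<close> identifies the limit, without a stationary law or ergodicity.\<close>

lemma time_average_limit:
  assumes "r \<noteq> 0" and eq: "\<And>x. x \<in> S \<Longrightarrow> generator f x = r * (c - g x)"
  shows "((\<lambda>T. 1 / T * (LINT \<omega>|M. (LINT t:{0..T}|lborel. g (X t \<omega>)))) \<longlongrightarrow> c) at_top"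
proof -
  have mean_g: "mean g t = c - mean (generator f) t / r" if t: "0 \<le> t" for t
  proof -
    have "mean (generator f) t = (LINT \<omega>|M. r * (c - g (X t \<omega>)))"
      unfolding mean_def using eq X_in_S[OF t] by (intro Bochner_Integration.integral_cong) auto
    also have "\<dots> = r * (c - mean g t)"
      using integrable_comp_X[OF t, of g] by (simp add: mean_def prob_space)
    finally show ?thesis using assms(1) by (simp add: field_simps)
  qed
  have "((\<lambda>T. c - (1 / T * (LINT t:{0..T}|lborel. mean (generator f) t)) / r) \<longlongrightarrow> c - 0 / r) at_top"
    by (intro tendsto_intros time_average_generator assms)
  moreover have "\<forall>\<^sub>F T in at_top. c - (1 / T * (LINT t:{0..T}|lborel. mean (generator f) t)) / r
      = 1 / T * (LINT \<omega>|M. (LINT t:{0..T}|lborel. g (X t \<omega>)))"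
    using eventually_gt_at_top[of 0]
  proof eventually_elim
    case (elim T)
    have "(LINT t:{0..T}|lborel. mean g t) = (LINT t:{0..T}|lborel. c - mean (generator f) t / r)"
      using mean_g by (intro set_lebesgue_integral_cong) auto
    also have "\<dots> = (LINT t:{0..T}|lborel. c) - (LINT t:{0..T}|lborel. mean (generator f) t / r)"
      using set_integrable_mean[of 0 T "generator f"]
      by (intro set_integral_diff set_integrable_divide)
         (auto simp: set_integrable_def emeasure_lborel_Icc_eq)
    also have "\<dots> = c * T - (LINT t:{0..T}|lborel. mean (generator f) t) / r"
      using elim by (simp add: set_lebesgue_integral_def)
    finally show ?case
      using elim by (simp add: integral_time_average field_simps)
  qed
  ultimately show ?thesis by (simp add: filterlim_cong[OF refl refl])
qed

end

section \<open>Generator of the clustered network\<close>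

lemma sum_single_jump:
  fixes r :: real
  assumes "finite S" "c \<in> S"
  shows "(\<Sum>y\<in>S. (if y = c then r else 0) * (f y - f x)) = r * (f c - f x)"
proof -
  have "(\<Sum>y\<in>S. (if y = c then r else 0) * (f y - f x)) = (\<Sum>y\<in>S. if y = c then r * (f c - f x) else 0)"
    by (rule sum.cong) auto
  then show ?thesis using assms by simp
qed

lemma finite_configs: "finite (configs m k)"
proof -
  have "{Node j i | j i. j < m \<and> i < k} = (\<lambda>(j, i). Node j i) ` ({..<m} \<times> {..<k})" by auto
  then show ?thesis by (simp add: configs_def)
qed

text \<open>Each summand of \<open>gossip_rate\<close> has one target, which lies in
  \<open>configs m k\<close> because \<open>x\<close> does. Summing over \<open>y\<close> leaves one
  difference of \<open>f\<close> per transition.\<close>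

lemma gossip_generator:
  assumes x: "x \<in> configs m k"
  shows "(\<Sum>y\<in>configs m k. gossip_rate m k lam_e lam_s lam_c A B x y * (f y - f x)) =
    lam_e * (f {} - f x) +
    (\<Sum>j | j < m \<and> CH j \<notin> x.
      dc_rate A lam_s m (card {j'. j' < m \<and> CH j' \<in> x}) * (f (insert (CH j) x) - f x)) +
    (\<Sum>j | j < m \<and> CH j \<in> x. \<Sum>i | i < k \<and> Node j i \<notin> x.
      dc_rate B lam_c k (card {i'. i' < k \<and> Node j i' \<in> x}) * (f (insert (Node j i) x) - f x))"
proof -
  let ?S = "configs m k"
  have mem: "{} \<in> ?S" "j < m \<Longrightarrow> insert (CH j) x \<in> ?S" "j < m \<Longrightarrow> i < k \<Longrightarrow> insert (Node j i) x \<in> ?S" for j i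
    using x by (auto simp: configs_def)
  show ?thesis
    unfolding gossip_rate_def distrib_right sum.distrib sum_distrib_right
    \<comment> \<open>The sum over \<open>y\<close> moves inward: past the clusterhead sum and the
      outer cluster sum first, then past the sum over end-nodes.\<close>
    by (subst (1 2) sum.swap[of _ _ ?S], subst sum.swap[of _ _ ?S])
       (simp add: sum_single_jump finite_configs mem)
qed

section \<open>Reach probabilities for one stage\<close>

text \<open>The probability that a given stale receiver becomes fresh before the next source update,
  when its sender stays fresh until then and \<open>l\<close> of its \<open>N\<close> receivers are already fresh.\<close>

fun reach_prob :: "scheme \<Rightarrow> real \<Rightarrow> real \<Rightarrow> nat \<Rightarrow> nat \<Rightarrow> real" where
  "reach_prob DC_noRC lam_e lam N l = lam / (lam + real N * lam_e)"
| "reach_prob DC_RC lam_e lam N l =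
     lam / (real (N - l) * lam_e) * (1 - (lam / (lam + lam_e)) ^ (N - l))"

text \<open>First-step analysis: the next relevant event is a source update (failure), service of
  the given receiver (success), or service of one of the \<open>N - Suc l\<close> others, after
  which \<open>Suc l\<close> are fresh. When \<open>Suc l = N\<close>, the last term has coefficient
  0 whatever \<open>reach_prob\<close> is there.\<close>

lemma reach_prob_step:
  assumes "l < N" "0 < lam_e" "0 < lam"
  shows "(lam_e + real (N - l) * dc_rate A lam N l) * reach_prob A lam_e lam N l =
    dc_rate A lam N l * (1 + real (N - Suc l) * reach_prob A lam_e lam N (Suc l))"
proof (cases A)
  case DC_noRC
  have N: "real (N - Suc l) = real (N - l) - 1" using assms(1) by (simp add: of_nat_diff)
  have "0 < lam + real N * lam_e" "0 < real N" using assms by (auto intro: add_pos_nonneg)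
  then show ?thesis unfolding DC_noRC N by (simp add: field_simps)
next
  case DC_RC
  \<comment> \<open>The total rate stays \<open>lam\<close>, so with
    \<open>a = lam / (lam + lam_e)\<close> the expected number of receivers served before an update
    is \<open>a + ... + a ^ (N - l)\<close>. Equal shares of it give the closed form in
    \<open>reach_prob\<close>. Here \<open>d\<close> counts the other stale receivers.\<close>
  obtain d where d: "N = l + Suc d" using assms(1) less_imp_Suc_add by auto
  have s: "(lam_e + lam) * (lam / (lam + lam_e)) = lam"
    using assms by (simp add: field_simps)
  have *: "(lam_e + lam) * (1 - (lam / (lam + lam_e)) ^ Suc d) = lam_e + lam * (1 - (lam / (lam + lam_e)) ^ d)"
    unfolding right_diff_distrib power_Suc mult.assoc[symmetric] s by simp
  have "(lam_e + real (N - l) * dc_rate A lam N l) * reach_prob A lam_e lam N l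
      = lam / (real (Suc d) * lam_e) * ((lam_e + lam) * (1 - (lam / (lam + lam_e)) ^ Suc d))"
    unfolding DC_RC d by (simp add: add_ac)
  also have "\<dots> = dc_rate A lam N l * (1 + real (N - Suc l) * reach_prob A lam_e lam N (Suc l))"
  proof -
    have "lam / (real (Suc d) * lam_e) * (lam_e + lam * (1 - P)) =
        lam / real (Suc d) * (1 + real d * (lam / (real d * lam_e) * (1 - P)))"
      if "d = 0 \<longrightarrow> P = 1" for P
    proof -
      \<comment> \<open>For \<open>d = 0\<close> division by zero makes the left side 0, and the
        right side is 0 because then \<open>P = 1\<close>.\<close>
      have "real d * (lam / (real d * lam_e) * (1 - P)) = lam * (1 - P) / lam_e"
        using that by (cases "d = 0") simp_all
      moreover have "lam / (c * lam_e) * (lam_e + q) = lam / c * (1 + q / lam_e)" if "0 < c" for c q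
        using that assms by (simp add: field_simps)
      ultimately show ?thesis by simp
    qed
    then show ?thesis unfolding * DC_RC d by (simp add: add_ac)
  qed
  finally show ?thesis .
qed

text \<open>The abstract freshness predicate \<open>P\<close> lets both stages share this. The
  factor \<open>b\<close> is the value once receiver \<open>i\<close> is served: 1 at the end-node
  stage, the end-node factor at the clusterhead stage. Separating \<open>i\<close> from the other
  stale receivers reduces the claim to \<open>reach_prob_step\<close>.\<close>

lemma stale_receivers_sum:
  assumes "i < N" "\<not> P i" "0 < lam_e" "0 < lam"
    and l: "l = card {j. j < N \<and> P j}"
    and f: "\<And>j. j < N \<Longrightarrow> \<not> P j \<Longrightarrow>
      f j = (if j = i then b else reach_prob A lam_e lam N (Suc l) * b)"
  shows "(\<Sum>j | j < N \<and> \<not> P j. dc_rate A lam N l * (f j - reach_prob A lam_e lam N l * b)) =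
    lam_e * (reach_prob A lam_e lam N l * b)"
proof -
  let ?r = "dc_rate A lam N l" and ?p = "reach_prob A lam_e lam N"
  let ?F = "{j. j < N \<and> P j}" and ?U = "{j. j < N \<and> \<not> P j}"
  have "?U = {..<N} - ?F" by auto
  then have U: "card ?U = N - l" by (simp add: l card_Diff_subset subset_eq)
  have "?F \<subset> {..<N}" using assms(1,2) by auto
  then have lN: "l < N" using psubset_card_mono[of "{..<N}" ?F] by (simp add: l)
  have rest: "card (?U - {i}) = N - Suc l" using U assms(1,2) by simp
  have "(\<Sum>j\<in>?U. ?r * (f j - ?p l * b))
      = ?r * (b - ?p l * b) + (\<Sum>j\<in>?U - {i}. ?r * (?p (Suc l) * b - ?p l * b))"
    using assms(1,2) by (subst sum.remove[of _ i]) (auto simp: f intro!: sum.cong)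
  also have "\<dots> = ?r * (b - ?p l * b) + real (N - Suc l) * (?r * (?p (Suc l) * b - ?p l * b))"
    by (simp only: sum_constant rest)
  also have "\<dots> = (?r * (1 + real (N - Suc l) * ?p (Suc l)) - real (N - l) * ?r * ?p l) * b"
    using lN by (simp add: of_nat_diff algebra_simps)
  also have "\<dots> = lam_e * (?p l * b)"
    unfolding reach_prob_step[OF lN assms(3,4), of A, symmetric] by (simp add: algebra_simps)
  finally show ?thesis .
qed

section \<open>Poisson equation for one end-node\<close>

text \<open>The probability, from configuration \<open>x\<close>, that \<open>Node j i\<close> is fresh just before the next
  source update.  By memorylessness the two stages contribute independent factors; this function
  solves the Poisson equation for the freshness of that node.\<close>

definition node_prob ::
  "nat \<Rightarrow> nat \<Rightarrow> real \<Rightarrow> real \<Rightarrow> real \<Rightarrow> scheme \<Rightarrow> scheme \<Rightarrow> nat \<Rightarrow> nat \<Rightarrow> entity set \<Rightarrow> real" where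
  "node_prob m k lam_e lam_s lam_c A B j i x =
     (if Node j i \<in> x then 1
      else (if CH j \<in> x then 1
            else reach_prob A lam_e lam_s m (card {j'. j' < m \<and> CH j' \<in> x})) *
        reach_prob B lam_e lam_c k (card {i'. i' < k \<and> Node j i' \<in> x}))"

lemma card_CH_insert:
  assumes "j < m" "CH j \<notin> x"
  shows "card {j'. j' < m \<and> CH j' \<in> insert (CH j) x} = Suc (card {j'. j' < m \<and> CH j' \<in> x})"
proof -
  have "{j'. j' < m \<and> CH j' \<in> insert (CH j) x} = insert j {j'. j' < m \<and> CH j' \<in> x}"
    using assms by auto
  then show ?thesis using assms by simp
qed

lemma card_Node_insert:
  assumes "i < k" "Node j i \<notin> x"
  shows "card {i'. i' < k \<and> Node j i' \<in> insert (Node j i) x} = Suc (card {i'. i' < k \<and> Node j i' \<in> x})"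
proof -
  have "{i'. i' < k \<and> Node j i' \<in> insert (Node j i) x} = insert i {i'. i' < k \<and> Node j i' \<in> x}"
    using assms by auto
  then show ?thesis using assms by simp
qed

text \<open>Three phases: once the node is fresh, insertions leave \<open>f\<close> at 1; with the
  node stale and its clusterhead fresh, only end-node updates in cluster \<open>j\<close> change
  \<open>f\<close>; with both stale, only clusterhead updates do. Unreachable members of
  \<open>configs m k\<close>, such as a fresh node under a stale clusterhead, are covered
  too.\<close>

lemma node_prob_poisson:
  fixes A B :: scheme
  assumes "0 < lam_e" "0 < lam_s" "0 < lam_c" "j < m" "i < k"
    and x: "x \<in> configs m k"
  defines "f \<equiv> node_prob m k lam_e lam_s lam_c A B j i"
  shows "(\<Sum>y\<in>configs m k. gossip_rate m k lam_e lam_s lam_c A B x y * (f y - f x)) =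
    lam_e * (f {} - (if Node j i \<in> x then 1 else 0))"
proof -
  let ?l = "card {j'. j' < m \<and> CH j' \<in> x}"
  let ?l' = "\<lambda>j. card {i'. i' < k \<and> Node j i' \<in> x}"
  let ?a = "reach_prob A lam_e lam_s m" and ?b = "reach_prob B lam_e lam_c k"
  let ?CH = "\<Sum>j' | j' < m \<and> CH j' \<notin> x. dc_rate A lam_s m ?l * (f (insert (CH j') x) - f x)"
  let ?Nd = "\<lambda>j'. \<Sum>i' | i' < k \<and> Node j' i' \<notin> x.
    dc_rate B lam_c k (?l' j') * (f (insert (Node j' i') x) - f x)"
  have other: "?Nd j' = 0" if "j' \<noteq> j" for j'
    using that by (intro sum.neutral) (simp add: f_def node_prob_def)
  \<comment> \<open>The source reset contributes \<open>lam_e * (f {} - f x)\<close> separately;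
    adding it cancels \<open>f x\<close>.\<close>
  have "?CH + (\<Sum>j' | j' < m \<and> CH j' \<in> x. ?Nd j') = lam_e * (f x - (if Node j i \<in> x then 1 else 0))"
  proof (cases "Node j i \<in> x")
    case True
    then show ?thesis by (simp add: f_def node_prob_def)
  next
    case stale: False
    show ?thesis
    proof (cases "CH j \<in> x")
      case True
      have fx: "f x = ?b (?l' j) * 1"
        using stale True by (simp add: f_def node_prob_def)
      have "?CH = 0" using stale True by (intro sum.neutral) (simp add: f_def node_prob_def)
      moreover have "(\<Sum>j' | j' < m \<and> CH j' \<in> x. ?Nd j') = ?Nd j"
        using True assms(4) other by (subst sum.remove[of _ j]) auto
      moreover have "?Nd j = lam_e * (?b (?l' j) * 1)"
        unfolding fx
      proof (rule stale_receivers_sum[OF assms(5) _ assms(1,3) refl])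
        fix i' assume i': "i' < k" "Node j i' \<notin> x"
        show "f (insert (Node j i') x) = (if i' = i then 1 else ?b (Suc (?l' j)) * 1)"
          unfolding f_def node_prob_def card_Node_insert[OF i'] using stale True by simp
      qed (rule stale)
      ultimately show ?thesis using stale fx by simp
    next
      case False
      have fx: "f x = ?a ?l * ?b (?l' j)"
        using stale False by (simp add: f_def node_prob_def)
      have "(\<Sum>j' | j' < m \<and> CH j' \<in> x. ?Nd j') = 0"
        using False by (intro sum.neutral[OF ballI] other) auto
      moreover have "?CH = lam_e * (?a ?l * ?b (?l' j))"
        unfolding fx
      proof (rule stale_receivers_sum[OF assms(4) _ assms(1,2) refl])
        fix j' assume j': "j' < m" "CH j' \<notin> x"
        show "f (insert (CH j') x) = (if j' = j then ?b (?l' j) else ?a (Suc ?l) * ?b (?l' j))"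
          unfolding f_def node_prob_def card_CH_insert[OF j'] using stale False by simp
      qed (rule False)
      ultimately show ?thesis using stale fx by simp
    qed
  qed
  then show ?thesis unfolding gossip_generator[OF x] by (simp add: algebra_simps)
qed

section \<open>Long-term average freshness\<close>

text \<open>At \<open>{}\<close> both counts of fresh receivers are 0, so \<open>node_prob\<close>
  is the product of the two stage values. Generic \<open>A\<close> and \<open>B\<close> cover all
  four configurations.\<close>

lemma avg_freshness_node:
  assumes "0 < lam_e" "0 < lam_s" "0 < lam_c" "j < m" "i < k"
    and "clustered_gossip m k lam_e lam_s lam_c A B M X"
  shows "avg_freshness M X (Node j i) =
    ereal (reach_prob A lam_e lam_s m 0 * reach_prob B lam_e lam_c k 0)"
proof -
  interpret ctmc M "configs m k" "gossip_rate m k lam_e lam_s lam_c A B" "{}" X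
    using assms(6) by (unfold_locales) (simp add: clustered_gossip_def)
  have "((\<lambda>T. 1 / T * (LINT \<omega>|M. (LINT t:{0..T}|lborel. if Node j i \<in> X t \<omega> then 1 else 0)))
      \<longlongrightarrow> node_prob m k lam_e lam_s lam_c A B j i {}) at_top"
    by (rule time_average_limit[where r = lam_e and f = "node_prob m k lam_e lam_s lam_c A B j i"])
       (use assms in \<open>simp_all add: generator_def node_prob_poisson\<close>)
  then have "((\<lambda>T. ereal (1 / T * (LINT \<omega>|M. (LINT t:{0..T}|lborel. fresh X (Node j i) t \<omega>))))
      \<longlongrightarrow> ereal (node_prob m k lam_e lam_s lam_c A B j i {})) at_top"
    by (simp only: fresh_def tendsto_ereal)
  \<comment> \<open>The averages converge, so their \<open>Limsup\<close> is the limit.\<close>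
  then have "avg_freshness M X (Node j i) = ereal (node_prob m k lam_e lam_s lam_c A B j i {})"
    unfolding avg_freshness_def by (intro lim_imp_Limsup) auto
  then show ?thesis by (simp add: node_prob_def)
qed

theorem mainTheorem5:
  fixes m k j i :: nat
    and lam_e lam_s lam_c a_s a_c :: real
    and M :: "'w measure"
    and X :: "real \<Rightarrow> 'w \<Rightarrow> entity set"
  assumes "m \<ge> 1" and "k \<ge> 1"
    and "lam_e > 0" and "lam_s > 0" and "lam_c > 0"
    and "a_s = lam_s / (lam_s + lam_e)"
    and "a_c = lam_c / (lam_c + lam_e)"
    and "j < m" and "i < k"
  shows
    "(clustered_gossip m k lam_e lam_s lam_c DC_noRC DC_noRC M X \<longrightarrow>
        avg_freshness M X (Node j i) =
          ereal (lam_s / (lam_s + real m * lam_e) * (lam_c / (lam_c + real k * lam_e)))) \<and>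
     (clustered_gossip m k lam_e lam_s lam_c DC_noRC DC_RC M X \<longrightarrow>
        avg_freshness M X (Node j i) =
          ereal (lam_s / (lam_s + real m * lam_e) *
            (lam_c / (real k * lam_e) * (1 - a_c ^ k)))) \<and>
     (clustered_gossip m k lam_e lam_s lam_c DC_RC DC_noRC M X \<longrightarrow>
        avg_freshness M X (Node j i) =
          ereal (1 / real m * (lam_s / lam_e) * (1 - a_s ^ m) *
            (lam_c / (lam_c + real k * lam_e)))) \<and>
     (clustered_gossip m k lam_e lam_s lam_c DC_RC DC_RC M X \<longrightarrow>
        avg_freshness M X (Node j i) =
          ereal ((1 / real m * (lam_s / lam_e) * (1 - a_s ^ m)) *
            (lam_c / (real k * lam_e) * (1 - a_c ^ k))))"
proof -
  note avg = avg_freshness_node[OF assms(3-5,8,9), where M = M and X = X]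
  show ?thesis
    unfolding assms(6,7)
    using avg[of DC_noRC DC_noRC] avg[of DC_noRC DC_RC] avg[of DC_RC DC_noRC] avg[of DC_RC DC_RC]
    by simp
qed

end
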